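(* There exist regular compactologies that are not generated by any topology; that is, there exist a regular compactological space $(S,\varkappa)$ such that no topology on the set $S$ generates $\varkappa$.
   Context: A compactological space is a set $S$ with a class $\varkappa$ of subsets (called compacts; $\varkappa$ is called a compactology on $S$) such that: (a) $\varkappa$ covers $S$ and is upward directed by inclusion; (b) each $K\in\varkappa$ carries a compact Hausdorff topology $\tau_K$ such that, whenever $K,L\in\varkappa$ and $K\subset L$, the inclusion $K\to L$ is continuous; (c) if $H\subset L$ and $L\in\varkappa$, then the closure of $H$ in $L$ (with the topology induced from $L$) belongs to $\varkappa$. A morphism from $(S,\varkappa)$ to $\mathbb{C}$ is a function $S\to\mathbb{C}$ whose restriction to every $K\in\varkappa$ is continuous. $(S,\varkappa)$ (and $\varkappa$) is regular if the morphisms from $(S,\varkappa)$ to $\mathbb{C}$ separate the points of $S$. A topology $\tau$ on $S$ generates $\varkappa$ if $\varkappa$ consists of exactly all $\tau$-compact subsets of $S$ (compact: every open cover has a finite subcover), each carrying the topology induced by $\tau$. *)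

theory Defs
  imports "HOL-Analysis.Analysis"
begin

text \<open>
  A compactological space is a carrier \<open>S\<close>, the class \<open>\<kappa>\<close> of its compacts, and a map \<open>\<tau>\<close> assigning
  to each compact \<open>K \<in> \<kappa>\<close> its topology \<open>\<tau> K\<close>; the values of \<open>\<tau>\<close> outside \<open>\<kappa>\<close> play no role.
  Upward directed families are nonempty by convention; this matters only for \<open>S = {}\<close>.
  In condition \<open>closure\<close>, the closure of \<open>H\<close> in \<open>L\<close> is required to belong to \<open>\<kappa>\<close> as a space,
  that is, with the topology induced from \<open>L\<close>.
\<close>

locale compactological_space =
  fixes S :: "'a set" and \<kappa> :: "'a set set" and \<tau> :: "'a set \<Rightarrow> 'a topology"
  assumes covers: "\<Union>\<kappa> = S"
    and nonempty: "\<kappa> \<noteq> {}"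
    and directed: "\<lbrakk>K \<in> \<kappa>; L \<in> \<kappa>\<rbrakk> \<Longrightarrow> \<exists>M\<in>\<kappa>. K \<subseteq> M \<and> L \<subseteq> M"
    and topspace: "K \<in> \<kappa> \<Longrightarrow> topspace (\<tau> K) = K"
    and compact: "K \<in> \<kappa> \<Longrightarrow> compact_space (\<tau> K)"
    and Hausdorff: "K \<in> \<kappa> \<Longrightarrow> Hausdorff_space (\<tau> K)"
    and inclusion: "\<lbrakk>K \<in> \<kappa>; L \<in> \<kappa>; K \<subseteq> L\<rbrakk> \<Longrightarrow> continuous_map (\<tau> K) (\<tau> L) (\<lambda>x. x)"
    and closure: "\<lbrakk>L \<in> \<kappa>; H \<subseteq> L\<rbrakk> \<Longrightarrow>
      \<tau> L closure_of H \<in> \<kappa> \<and>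
      \<tau> (\<tau> L closure_of H) = subtopology (\<tau> L) (\<tau> L closure_of H)"

text \<open>Functions on \<open>S\<close> are total functions whose values outside \<open>S = \<Union>\<kappa>\<close> are irrelevant.\<close>

definition compactological_morphism ::
    "'a set set \<Rightarrow> ('a set \<Rightarrow> 'a topology) \<Rightarrow> ('a \<Rightarrow> complex) \<Rightarrow> bool" where
  "compactological_morphism \<kappa> \<tau> f \<longleftrightarrow> (\<forall>K\<in>\<kappa>. continuous_map (\<tau> K) euclidean f)"

locale regular_compactological_space = compactological_space +
  assumes separates: "\<lbrakk>x \<in> S; y \<in> S; x \<noteq> y\<rbrakk> \<Longrightarrow>
    \<exists>f. compactological_morphism \<kappa> \<tau> f \<and> f x \<noteq> f y"

definition generates_compactology ::
    "'a topology \<Rightarrow> 'a set set \<Rightarrow> ('a set \<Rightarrow> 'a topology) \<Rightarrow> bool" where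
  "generates_compactology T \<kappa> \<tau> \<longleftrightarrow>
     \<kappa> = {K. compactin T K} \<and> (\<forall>K\<in>\<kappa>. \<tau> K = subtopology T K)"

end

theory Submission
  imports Defs
begin

text \<open>
  Take the compact sets \<open>K \<subseteq> \<real>\<close> over which the identity is summable, with their usual topologies.
  Every infinite subset of \<open>{1/n | n \<ge> 1}\<close> contains an infinite summable subset, so a topology
  inducing the usual topology on all these sets makes \<open>1/n\<close> converge to \<open>0\<close>. Hence
  \<open>{0} \<union> {1/n | n \<ge> 1}\<close> is compact for it, although the harmonic series diverges.
\<close>

definition summable_compacts :: "real set set" where
  "summable_compacts = {K. compact K \<and> (\<lambda>x. x) summable_on K}"

text \<open>\<open>summable_on\<close> is unconditional summability, so it passes to subsets and
  finite unions. This gives directedness, and it gives the closure condition because the closure of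
  \<open>H\<close> in \<open>L\<close> is a closed subset of the compact set \<open>L\<close>. The
  embedding of the reals into the complex numbers alone separates all points.\<close>

lemma regular_summable_compacts:
  "regular_compactological_space UNIV summable_compacts top_of_set"
proof
  show "\<Union>summable_compacts = UNIV"
  proof -
    have "{x} \<in> summable_compacts" for x
      by (simp add: summable_compacts_def)
    then show ?thesis by blast
  qed
  then show "summable_compacts \<noteq> {}" by auto
  show "\<exists>M\<in>summable_compacts. K \<subseteq> M \<and> L \<subseteq> M"
    if "K \<in> summable_compacts" "L \<in> summable_compacts" for K L
  proof (intro bexI conjI)
    show "K \<union> L \<in> summable_compacts"
      using that by (simp add: summable_compacts_def compact_Un summable_on_union)
  qed auto
  show "topspace (top_of_set K) = K" for K :: "real set" by simp
  show "compact_space (top_of_set K)" if "K \<in> summable_compacts" for K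
    using that by (simp add: summable_compacts_def compact_space_subtopology)
  show "Hausdorff_space (top_of_set K)" for K :: "real set"
    by (simp add: Hausdorff_space_subtopology)
  show "continuous_map (top_of_set K) (top_of_set L) (\<lambda>x. x)" if "K \<subseteq> L" for K L :: "real set"
    using that by auto
  show "top_of_set L closure_of H \<in> summable_compacts \<and>
      top_of_set (top_of_set L closure_of H) =
      subtopology (top_of_set L) (top_of_set L closure_of H)"
    if "L \<in> summable_compacts" "H \<subseteq> L" for L H
  proof -
    let ?C = "top_of_set L closure_of H"
    have sub: "?C \<subseteq> L"
      using closure_of_subset_topspace[of "top_of_set L" H] by simp
    have "closedin (top_of_set L) ?C" by simp
    then have "compact ?C"
      using that closedin_compact unfolding summable_compacts_def by blast
    moreover have "(\<lambda>x. x) summable_on ?C"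
      using that sub summable_on_subset_banach unfolding summable_compacts_def by blast
    moreover have "L \<inter> ?C = ?C" using sub by blast
    ultimately show ?thesis
      by (simp add: summable_compacts_def subtopology_subtopology)
  qed
  show "\<exists>f. compactological_morphism summable_compacts top_of_set f \<and> f x \<noteq> f y"
    if "x \<noteq> y" for x y
    using that
    by (intro exI[of _ complex_of_real])
       (auto simp: compactological_morphism_def intro!: continuous_intros)
qed

text \<open>Thin out \<open>N\<close> by keeping only its elements at positions \<open>2 ^ n\<close>
  in increasing order. The element at position k is at least k, so the reciprocals are dominated by
  a geometric series.\<close>

lemma infinite_nat_summable_subsequence:
  fixes N :: "nat set"
  assumes "infinite N"
  obtains r where "strict_mono r" "range r \<subseteq> N" "summable (\<lambda>n. inverse (real (Suc (r n))))"
proof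
  define r where "r = (\<lambda>n. enumerate N (2 ^ n))"
  show "strict_mono r"
    using assms by (auto simp: r_def strict_mono_def enumerate_mono_iff)
  show "range r \<subseteq> N"
    using assms by (auto simp: r_def enumerate_in_set)
  have "inverse (real (Suc (r n))) \<le> (1/2) ^ n" for n
  proof -
    have "2 ^ n \<le> r n"
      unfolding r_def using assms by (rule le_enumerate)
    then have "2 ^ n \<le> real (Suc (r n))"
      by (metis le_SucI of_nat_le_iff of_nat_numeral of_nat_power)
    then have "inverse (real (Suc (r n))) \<le> inverse (2 ^ n)"
      by (intro le_imp_inverse_le) auto
    then show ?thesis by (simp add: power_one_over inverse_eq_divide)
  qed
  then show "summable (\<lambda>n. inverse (real (Suc (r n))))"
    by (intro summable_comparison_test'[OF summable_geometric[of "1/2"]]) auto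
qed

lemma not_generates_summable_compacts:
  "\<not> generates_compactology T summable_compacts top_of_set"
proof
  assume "generates_compactology T summable_compacts top_of_set"
  then have compactin_iff: "compactin T K \<longleftrightarrow> K \<in> summable_compacts"
    and induced: "K \<in> summable_compacts \<Longrightarrow> top_of_set K = subtopology T K" for K
    unfolding generates_compactology_def by auto
  define s where "s = (\<lambda>n. inverse (real (Suc n)))"
  define C where "C = insert 0 (range s)"
  have inj: "inj s" by (auto simp: inj_on_def s_def)
  have lim: "s \<longlonglongrightarrow> 0" unfolding s_def by (rule LIMSEQ_inverse_real_of_nat)
  \<comment> \<open>This is convergence of \<open>s\<close> to 0 in \<open>T\<close>. If infinitely
    many terms avoided \<open>U\<close>, a sparse subsequence of them together with 0 would form
    some \<open>K\<close> in \<open>summable_compacts\<close>. There \<open>T\<close> induces the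
    usual topology, so the trace of \<open>U\<close> on \<open>K\<close> is a usual neighbourhood of
    0 and must meet the subsequence.\<close>
  have cofinite: "finite {n. s n \<notin> U}" if U: "openin T U" "0 \<in> U" for U
  proof (rule ccontr)
    assume "infinite {n. s n \<notin> U}"
    then obtain r where r: "strict_mono r" "range r \<subseteq> {n. s n \<notin> U}" "summable (\<lambda>n. s (r n))"
      using infinite_nat_summable_subsequence unfolding s_def by blast
    define K where "K = insert 0 (range (s \<circ> r))"
    have lim_r: "(s \<circ> r) \<longlonglongrightarrow> 0"
      using lim r(1) by (rule LIMSEQ_subseq_LIMSEQ)
    have "inj (s \<circ> r)"
      using inj r(1) by (simp add: inj_compose strict_mono_imp_inj_on)
    \<comment> \<open>The terms are positive, so convergence of the series is absolute and hence
      unconditional.\<close>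
    moreover have "((\<lambda>x. x) \<circ> (s \<circ> r)) summable_on UNIV"
      using r(3) by (intro norm_summable_imp_summable_on) (auto simp: s_def)
    ultimately have "(\<lambda>x. x) summable_on range (s \<circ> r)"
      using summable_on_reindex by blast
    then have "K \<in> summable_compacts"
      using compact_sequence_with_limit[OF lim_r]
      by (simp add: summable_compacts_def K_def summable_on_insert_iff)
    then have "openin (top_of_set K) (U \<inter> K)"
      using U(1) induced by (simp add: openin_subtopology_Int)
    then obtain V where V: "open V" "U \<inter> K = K \<inter> V"
      by (auto simp: openin_open)
    then have "0 \<in> V" using U(2) K_def by blast
    then obtain n where "(s \<circ> r) n \<in> V"
      using topological_tendstoD[OF lim_r V(1)] eventually_happens'[OF sequentially_bot] by blast
    then have "s (r n) \<in> U" using V(2) K_def by auto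
    then show False using r(2) by auto
  qed
  \<comment> \<open>Compact sets lie in the underlying space, so the singletons force every real to
    be a point of \<open>T\<close>.\<close>
  have "{x} \<in> summable_compacts" for x by (simp add: summable_compacts_def)
  then have topspace: "topspace T = UNIV"
    using compactin_iff compactin_subset_topspace by blast
  have "compactin T C"
    unfolding compactin_def
  proof (intro conjI allI impI)
    fix \<U> assume \<U>: "Ball \<U> (openin T) \<and> C \<subseteq> \<Union>\<U>"
    \<comment> \<open>By \<open>cofinite\<close>, a single member of the cover containing 0 leaves
      only finitely many terms to cover.\<close>
    then obtain U where U: "U \<in> \<U>" "0 \<in> U" by (auto simp: C_def)
    have "finite (s ` {n. s n \<notin> U})"
      using cofinite U \<U> by blast
    moreover have "s ` {n. s n \<notin> U} \<subseteq> \<Union>\<U>"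
      using \<U> by (auto simp: C_def)
    ultimately obtain \<F> where "finite \<F>" "\<F> \<subseteq> \<U>" "s ` {n. s n \<notin> U} \<subseteq> \<Union>\<F>"
      by (rule finite_subset_Union)
    then show "\<exists>\<F>. finite \<F> \<and> \<F> \<subseteq> \<U> \<and> C \<subseteq> \<Union>\<F>"
      using U by (intro exI[of _ "insert U \<F>"]) (auto simp: C_def)
  qed (simp add: topspace)
  then have "(\<lambda>x. x) summable_on range s"
    unfolding compactin_iff summable_compacts_def C_def
    by (simp add: summable_on_insert_iff)
  then have "s summable_on UNIV"
    using summable_on_reindex[OF inj, of "\<lambda>x. x"] by (simp add: o_def)
  then have "summable s"
    by (rule summable_on_imp_summable)
  \<comment> \<open>The shift by one adds only the term at index 0, where
    \<open>inverse 0 = 0\<close>.\<close>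
  then have "summable (\<lambda>n. inverse (real n))"
    unfolding s_def by (rule summable_Suc_iff[THEN iffD1])
  then show False
    using not_summable_harmonic[where 'a = real] by simp
qed

theorem theorem1p1:
  "\<exists>(S :: real set) \<kappa> \<tau>. regular_compactological_space S \<kappa> \<tau> \<and>
     \<not> (\<exists>T. topspace T = S \<and> generates_compactology T \<kappa> \<tau>)"
  using regular_summable_compacts not_generates_summable_compacts by blast

end
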